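(* Let $n\geq 2$ and let $\sigma=\{v_0,\dots,v_n\}\subseteq\mathbb{R}^n$ be a non-degenerate $n$-dimensional simplex. Then for every face $\tau$ of $\sigma$ (that is, every non-empty proper subset $\tau\subsetneq\sigma$ of the vertex set), with opposite face $\tau^*=\sigma\setminus\tau$, $$\mathrm{alt}(\tau,\tau^* )\geq 2\,\frac{\mathrm{height}(\sigma)}{n+1}.$$
   Context: $\mathbb{R}^n$ carries the standard Euclidean norm $\|\cdot\|$. A simplex is identified with its set of vertices; $\sigma=\{v_0,\dots,v_n\}\subseteq\mathbb{R}^n$ is non-degenerate if its vertices are affinely independent. For a face $\tau$ of $\sigma$ with opposite face $\tau^*=\sigma\setminus\tau$, let $\mathcal{F}_\tau$ and $\mathcal{F}_{\tau^*}$ denote the affine hulls of $\tau$ and $\tau^*$. The (generalized) altitude of $\tau$ and $\tau^*$ is $$\mathrm{alt}(\tau,\tau^* )=\min_{u\in\mathcal{F}_\tau,\;u^*\in\mathcal{F}_{\tau^*}}\|u-u^*\|.$$ The height of $\sigma$ is the minimum altitude of its vertices: $$\mathrm{height}(\sigma)=\min_{i\in\{0,\dots,n\}}\mathrm{alt}(\{v_i\},\sigma\setminus\{v_i\}).$$ *)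

theory Defs
  imports "HOL-Analysis.Analysis"
begin

text \<open>
  A simplex is represented by its set of vertices. The infimum below is attained whenever both
  vertex sets are non-empty (see \<open>alt_is_minimum\<close>), so it is the minimum of the distances.
\<close>

definition alt :: "'a::euclidean_space set \<Rightarrow> 'a set \<Rightarrow> real" where
  "alt \<tau> \<tau>' = Inf {norm (u - u') | u u'. u \<in> affine hull \<tau> \<and> u' \<in> affine hull \<tau>'}"

definition height :: "'a::euclidean_space set \<Rightarrow> real" where
  "height \<sigma> = Min ((\<lambda>v. alt {v} (\<sigma> - {v})) ` \<sigma>)"

lemma alt_is_minimum:
  fixes \<tau> \<tau>' :: "'a::euclidean_space set"
  assumes "\<tau> \<noteq> {}" and "\<tau>' \<noteq> {}"
  shows "\<exists>u\<in>affine hull \<tau>. \<exists>u'\<in>affine hull \<tau>'. alt \<tau> \<tau>' = norm (u - u')"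
    and "\<And>u u'. u \<in> affine hull \<tau> \<Longrightarrow> u' \<in> affine hull \<tau>' \<Longrightarrow> alt \<tau> \<tau>' \<le> norm (u - u')"
proof -
  let ?D = "{u - u' | u u'. u \<in> affine hull \<tau> \<and> u' \<in> affine hull \<tau>'}"
  let ?N = "{norm (u - u') | u u'. u \<in> affine hull \<tau> \<and> u' \<in> affine hull \<tau>'}"
  have "(1 - r) *\<^sub>R x + r *\<^sub>R y \<in> ?D" if "x \<in> ?D" "y \<in> ?D" for x y and r :: real
  proof -
    from that obtain a b c d where
      H: "a \<in> affine hull \<tau>" "b \<in> affine hull \<tau>'" "c \<in> affine hull \<tau>" "d \<in> affine hull \<tau>'"
      and xy: "x = a - b" "y = c - d"
      by blast
    let ?x = "(1 - r) *\<^sub>R a + r *\<^sub>R c" and ?y = "(1 - r) *\<^sub>R b + r *\<^sub>R d"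
    have "?x \<in> affine hull \<tau>" "?y \<in> affine hull \<tau>'"
      using H by (auto intro!: mem_affine)
    moreover have "(1 - r) *\<^sub>R x + r *\<^sub>R y = ?x - ?y"
      by (simp add: xy algebra_simps)
    ultimately show ?thesis by blast
  qed
  then have "affine ?D" unfolding affine_alt[of ?D] by blast
  then have "closed ?D" by (rule affine_closed)
  moreover have "?D \<noteq> {}"
  proof -
    obtain a b where "a \<in> affine hull \<tau>" "b \<in> affine hull \<tau>'"
      using assms hull_inc by (metis ex_in_conv)
    then show ?thesis by blast
  qed
  ultimately obtain d where d: "d \<in> ?D" "\<And>y. y \<in> ?D \<Longrightarrow> dist 0 d \<le> dist 0 y"
    using distance_attains_inf[of ?D 0] by blast
  have le: "norm d \<le> r" if "r \<in> ?N" for r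
    using that d(2) by auto
  have "norm d \<in> ?N" using d(1) by blast
  then have eq: "alt \<tau> \<tau>' = norm d"
    unfolding alt_def using le by (rule cInf_eq_minimum)
  show "\<exists>u\<in>affine hull \<tau>. \<exists>u'\<in>affine hull \<tau>'. alt \<tau> \<tau>' = norm (u - u')"
    using d(1) eq by blast
  show "alt \<tau> \<tau>' \<le> norm (u - u')" if "u \<in> affine hull \<tau>" "u' \<in> affine hull \<tau>'" for u u'
    unfolding eq using that by (intro le) blast
qed

end

theory Submission
  imports Defs
begin

text \<open>
  Let \<open>u - u'\<close> join the affine hulls of \<open>\<tau>\<close> and \<open>\<sigma> - \<tau>\<close>, and write it as \<open>\<Sum>v\<in>\<sigma>. c v *\<^sub>R v\<close>
  using affine coordinates of \<open>u\<close> and \<open>u'\<close>. The coefficients add up to \<open>1\<close> over \<open>\<tau>\<close> and to \<open>-1\<close>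
  over \<open>\<sigma> - \<tau>\<close>, so some \<open>\<bar>c v\<bar>\<close> is at least \<open>2 / card \<sigma>\<close>. Dividing by \<open>c v\<close> turns \<open>u - u'\<close> into a
  vector from the affine hull of \<open>\<sigma> - {v}\<close> to \<open>v\<close>, whose length is at least the height.
\<close>

lemma alt_nonneg:
  assumes "\<tau> \<noteq> {}" "\<tau>' \<noteq> {}"
  shows "0 \<le> alt \<tau> \<tau>'"
  using alt_is_minimum(1)[OF assms] by auto

lemma norm_sum_scaleR_ge_alt:
  fixes S :: "'a::euclidean_space set"
  assumes fin: "finite S" and v: "v \<in> S" and ne: "S - {v} \<noteq> {}" and c: "sum c S = 0"
  shows "\<bar>c v\<bar> * alt {v} (S - {v}) \<le> norm (\<Sum>x\<in>S. c x *\<^sub>R x)"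
proof (cases "c v = 0")
  case False
  \<comment> \<open>The coefficients other than \<open>c v\<close> add up to \<open>- c v\<close>,
    so division by \<open>- c v\<close> makes them affine weights.\<close>
  define w where "w = (\<Sum>x\<in>S - {v}. (- c x / c v) *\<^sub>R x)"
  have "sum c (S - {v}) = - c v"
    using c sum.remove[OF fin v, of c] by simp
  then have "(\<Sum>x\<in>S - {v}. - c x / c v) = 1"
    using False by (simp add: sum_negf flip: sum_divide_distrib)
  then have "w \<in> affine hull (S - {v})"
    using fin ne unfolding w_def by (subst affine_hull_finite) auto
  then have "alt {v} (S - {v}) \<le> norm (v - w)"
    using ne by (intro alt_is_minimum(2)) auto
  then have "\<bar>c v\<bar> * alt {v} (S - {v}) \<le> norm (c v *\<^sub>R (v - w))"
    by (simp add: mult_left_mono)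
  also have "c v *\<^sub>R (v - w) = (\<Sum>x\<in>S. c x *\<^sub>R x)"
    using False
    by (simp add: w_def sum.remove[OF fin v] scaleR_right_distrib scaleR_sum_right sum_negf)
  finally show ?thesis .
qed simp

lemma alt_opposite_face_ge:
  fixes \<sigma> \<tau> :: "'a::euclidean_space set"
  assumes fin: "finite \<sigma>" and ne: "\<tau> \<noteq> {}" and sub: "\<tau> \<subset> \<sigma>"
  shows "2 * (height \<sigma> / real (card \<sigma>)) \<le> alt \<tau> (\<sigma> - \<tau>)"
proof -
  have fin': "finite \<tau>" "finite (\<sigma> - \<tau>)" and ne': "\<sigma> - \<tau> \<noteq> {}"
    using fin sub finite_subset by auto
  \<comment> \<open>A non-empty proper subset forces \<sigma> to have at least two vertices.\<close>
  have facet: "\<sigma> - {v} \<noteq> {}" for v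
    using ne sub by auto
  have card_pos: "0 < real (card \<sigma>)"
    using fin ne sub by (auto simp: card_gt_0_iff)
  have height_le: "height \<sigma> \<le> alt {v} (\<sigma> - {v})" if "v \<in> \<sigma>" for v
    unfolding height_def using fin that by (intro Min_le) auto
  have height_nonneg: "0 \<le> height \<sigma>"
    unfolding height_def using fin ne sub facet by (subst Min_ge_iff) (auto intro: alt_nonneg)
  obtain u u' where u: "u \<in> affine hull \<tau>" "u' \<in> affine hull (\<sigma> - \<tau>)"
    and alt_eq: "alt \<tau> (\<sigma> - \<tau>) = norm (u - u')"
    using alt_is_minimum(1)[OF ne ne'] by blast
  obtain a where a: "sum a \<tau> = 1" "(\<Sum>x\<in>\<tau>. a x *\<^sub>R x) = u"
    using u(1) fin' by (auto simp: affine_hull_finite)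
  obtain b where b: "sum b (\<sigma> - \<tau>) = 1" "(\<Sum>x\<in>\<sigma> - \<tau>. b x *\<^sub>R x) = u'"
    using u(2) fin' by (auto simp: affine_hull_finite)
  define c where "c x = (if x \<in> \<tau> then a x else - b x)" for x
  have split: "sum f \<sigma> = sum f \<tau> + sum f (\<sigma> - \<tau>)" for f :: "'a \<Rightarrow> 'b::comm_monoid_add"
    using sum.subset_diff[of \<tau> \<sigma> f] fin sub by (auto simp: add.commute)
  have sums: "sum c \<tau> = 1" "sum c (\<sigma> - \<tau>) = - 1"
    using a(1) b(1) by (simp_all add: c_def sum_negf)
  have repr: "(\<Sum>x\<in>\<sigma>. c x *\<^sub>R x) = u - u'"
    using a(2) b(2) by (simp add: split c_def sum_negf)
  \<comment> \<open>The triangle inequality, applied to each face separately, gives at least 1 from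
    \<tau> and at least 1 from its complement.\<close>
  have "2 \<le> (\<Sum>x\<in>\<sigma>. \<bar>c x\<bar>)"
    using sum_abs[of c \<tau>] sum_abs[of c "\<sigma> - \<tau>"] by (simp add: split sums)
  \<comment> \<open>Pigeonhole: if every term were smaller, the sum would be below 2.\<close>
  then obtain v where v: "v \<in> \<sigma>" "2 / real (card \<sigma>) \<le> \<bar>c v\<bar>"
    using sum_bounded_above_strict[of \<sigma> "\<lambda>x. \<bar>c x\<bar>" "2 / real (card \<sigma>)"] card_pos
    by fastforce
  have "2 / real (card \<sigma>) * height \<sigma> \<le> \<bar>c v\<bar> * alt {v} (\<sigma> - {v})"
    using v height_le height_nonneg by (intro mult_mono) auto
  also have "\<dots> \<le> norm (u - u')"
    using norm_sum_scaleR_ge_alt[OF fin v(1) facet, of c] by (simp add: split sums flip: repr)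
  finally show ?thesis
    by (simp add: alt_eq)
qed

theorem lemma6:
  fixes \<sigma> \<tau> :: "(real ^ 'n) set"
  assumes "CARD('n) \<ge> 2"
    and "card \<sigma> = CARD('n) + 1"
    and "\<not> affine_dependent \<sigma>"
    and "\<tau> \<noteq> {}"
    and "\<tau> \<subset> \<sigma>"
  shows "alt \<tau> (\<sigma> - \<tau>) \<ge> 2 * (height \<sigma> / (real CARD('n) + 1))"
proof -
  \<comment> \<open>An infinite set has \<open>card\<close> 0, which is not
    \<open>CARD('n) + 1\<close>.\<close>
  have "finite \<sigma>"
    using assms(2) card.infinite by fastforce
  from alt_opposite_face_ge[OF this assms(4,5)] show ?thesis
    by (simp add: assms(2) add.commute)
qed

end
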